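(* Let $Q\in\mathbb{R}^{d\times d}$ be positive semidefinite and assume that the system (S) is an SLTI-PHS with $Q$. Then $\mathfrak{M}_Q\le0$, i.e. $\mathfrak{M}_Q$ is negative semidefinite.
   Context: Let $d,n,k\in\mathbb{N}$. The system (S) is the $\mathbb{R}^d\times\mathbb{R}^n$-valued stochastic input-state-output system $$dX_t=b(X_t,u_t)\,dt+\sigma(X_t,u_t)\,dW_t,\quad Y_t=f(X_t,u_t),\quad X_0=x_0\in\mathbb{R}^d,\quad u\in\mathcal{A},$$ driven by an $\mathbb{R}^k$-valued Wiener process $W$, with coefficients $b:\mathbb{R}^d\times\mathbb{R}^n\to\mathbb{R}^d$, $\sigma:\mathbb{R}^d\times\mathbb{R}^n\to\mathbb{R}^{d\times k}$ (with $i$-th column $\sigma^i$), $f:\mathbb{R}^d\times\mathbb{R}^n\to\mathbb{R}^n$, and a set $\mathcal{A}$ of $\mathbb{R}^n$-valued progressively measurable controls. Definition (SLTI-PHS). The system (S) is a stochastic, linear, time-invariant port-Hamiltonian system (SLTI-PHS) (also: an SLTI-PHS with $Q$) if there exist $J,R,Q,\overline{\mathfrak{A}}(j)\in\mathbb{R}^{d\times d}$, $F,P,\mathfrak{B}(j)\in\mathbb{R}^{d\times n}$ ($j=1,\dots,k$), $S,N\in\mathbb{R}^{n\times n}$ such that $J=-J^\top$, $R=R^\top$, $Q=Q^\top\ge0$, $S=S^\top$, $N=-N^\top$, $$\begin{pmatrix}R&P\\P^\top&S\end{pmatrix}\ge0,$$ and for all $x\in\mathbb{R}^d$, $v\in\mathbb{R}^n$,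 $i\in\{1,\dots,k\}$ $$b(x,v)=\Big(J-R-\tfrac12\sum_{j=1}^k\overline{\mathfrak{A}}^\top(j)Q\overline{\mathfrak{A}}(j)\Big)Qx+(F-P)v,\qquad \sigma^i(x,v)=\overline{\mathfrak{A}}(i)Qx+\mathfrak{B}(i)v,$$ $$f(x,v)=\Big(F+P+\sum_{j=1}^k\overline{\mathfrak{A}}^\top(j)Q\mathfrak{B}(j)\Big)^\top Qx+\Big(S+N+\tfrac12\sum_{j=1}^k\mathfrak{B}^\top(j)Q\mathfrak{B}(j)\Big)v.$$ Any SLTI-PHS has linear coefficients, $b(x,v)=Ax+Bv$, $\sigma^j(x,v)=\mathfrak{A}(j)x+\mathfrak{B}(j)v$, $f(x,v)=Cx+Dv$, with uniquely determined system matrices $A\in\mathbb{R}^{d\times d}$, $B\in\mathbb{R}^{d\times n}$, $\mathfrak{A}(j)\in\mathbb{R}^{d\times d}$, $\mathfrak{B}(j)\in\mathbb{R}^{d\times n}$, $C\in\mathbb{R}^{n\times d}$, $D\in\mathbb{R}^{n\times n}$. For symmetric $Q\in\mathbb{R}^{d\times d}$ define $$\mathfrak{M}_Q:=\begin{pmatrix}QA+A^\top Q+\sum_{j=1}^k\mathfrak{A}^\top(j)Q\mathfrak{A}(j)&QB-C^\top+\sum_{j=1}^k\mathfrak{A}^\top(j)Q\mathfrak{B}(j)\\ B^\top Q-C+\sum_{j=1}^k\mathfrak{B}^\top(j)Q\mathfrak{A}(j)&-(D+D^\top)+\sum_{j=1}^k\mathfrak{B}^\top(j)Q\mathfrak{B}(j)\end{pmatrix}.$$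 *)

theory Defs
  imports "HOL-Analysis.Analysis"
begin

definition pos_semidef :: "real^'m^'m \<Rightarrow> bool" where
  "pos_semidef M \<longleftrightarrow> transpose M = M \<and> (\<forall>x. 0 \<le> x \<bullet> (M *v x))"

definition neg_semidef :: "real^'m^'m \<Rightarrow> bool" where
  "neg_semidef M \<longleftrightarrow> transpose M = M \<and> (\<forall>x. x \<bullet> (M *v x) \<le> 0)"

text \<open>The block matrix with rows (M11, M12) and (M21, M22); indices of the first block are
  tagged \<open>Inl\<close>, those of the second \<open>Inr\<close>.\<close>

definition block_matrix ::
  "real^'d^'d \<Rightarrow> real^'n^'d \<Rightarrow> real^'d^'n \<Rightarrow> real^'n^'n
    \<Rightarrow> real^('d::finite + 'n::finite)^('d + 'n)" where
  "block_matrix M11 M12 M21 M22 =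
    (\<chi> i j. case i of
        Inl a \<Rightarrow> (case j of Inl c \<Rightarrow> M11 $ a $ c | Inr e \<Rightarrow> M12 $ a $ e)
      | Inr a \<Rightarrow> (case j of Inl c \<Rightarrow> M21 $ a $ c | Inr e \<Rightarrow> M22 $ a $ e))"

text \<open>The stochastic input-state-output system
  \<open>dX = b(X,u) dt + \<sigma>(X,u) dW\<close>, \<open>Y = f(X,u)\<close>
  enters only through its coefficient functions: being an SLTI-PHS and the system matrices do
  not depend on the Wiener process, the initial value or the set of controls. A system is
  therefore given by \<open>b\<close>, \<open>\<sigma>\<close> and \<open>f\<close>; the dimensions of state, input/output and noise are the
  cardinalities of \<open>'d\<close>, \<open>'n\<close> and \<open>'k\<close>. The bound variable \<open>Aq\<close> below stands for
  the overlined \<open>\<AA>\<close>, which is multiplied by \<open>Q\<close> in the diffusion coefficient.\<close>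

definition slti_phs_with ::
  "real^'d^'d
    \<Rightarrow> ((real^'d) \<times> (real^'n) \<Rightarrow> real^'d)
    \<Rightarrow> ((real^'d) \<times> (real^'n) \<Rightarrow> real^'k^'d)
    \<Rightarrow> ((real^'d) \<times> (real^'n) \<Rightarrow> real^'n) \<Rightarrow> bool" where
  "slti_phs_with Q b \<sigma> f \<longleftrightarrow>
    pos_semidef Q \<and>
    (\<exists>(J :: real^'d^'d) (R :: real^'d^'d) (Aq :: 'k \<Rightarrow> real^'d^'d)
      (F :: real^'n^'d) (P :: real^'n^'d) (\<BB> :: 'k \<Rightarrow> real^'n^'d)
      (S :: real^'n^'n) (N :: real^'n^'n).
      J = - transpose J \<and> R = transpose R \<and> S = transpose S \<and> N = - transpose N \<and>
      pos_semidef (block_matrix R P (transpose P) S) \<and>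
      (\<forall>x v.
        b (x, v) =
          ((J - R - (1/2) *\<^sub>R (\<Sum>j\<in>UNIV. transpose (Aq j) ** Q ** Aq j)) ** Q) *v x
          + (F - P) *v v \<and>
        (\<forall>i. column i (\<sigma> (x, v)) = (Aq i ** Q) *v x + \<BB> i *v v) \<and>
        f (x, v) =
          (transpose (F + P + (\<Sum>j\<in>UNIV. transpose (Aq j) ** Q ** \<BB> j)) ** Q) *v x
          + (S + N + (1/2) *\<^sub>R (\<Sum>j\<in>UNIV. transpose (\<BB> j) ** Q ** \<BB> j)) *v v))"

definition system_matrices ::
  "((real^'d) \<times> (real^'n) \<Rightarrow> real^'d)
    \<Rightarrow> ((real^'d) \<times> (real^'n) \<Rightarrow> real^'k^'d)
    \<Rightarrow> ((real^'d) \<times> (real^'n) \<Rightarrow> real^'n)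
    \<Rightarrow> real^'d^'d \<Rightarrow> real^'n^'d
    \<Rightarrow> ('k \<Rightarrow> real^'d^'d) \<Rightarrow> ('k \<Rightarrow> real^'n^'d)
    \<Rightarrow> real^'d^'n \<Rightarrow> real^'n^'n \<Rightarrow> bool" where
  "system_matrices b \<sigma> f A B \<AA> \<BB> C D \<longleftrightarrow>
    (\<forall>x v. b (x, v) = A *v x + B *v v \<and>
           (\<forall>j. column j (\<sigma> (x, v)) = \<AA> j *v x + \<BB> j *v v) \<and>
           f (x, v) = C *v x + D *v v)"

lemma slti_phs_with_system_matrices_exist:
  assumes "slti_phs_with Q b \<sigma> f"
  shows "\<exists>A B \<AA> \<BB> C D. system_matrices b \<sigma> f A B \<AA> \<BB> C D"
  using assms unfolding slti_phs_with_def system_matrices_def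
  by (elim conjE exE) (rule exI, rule exI, rule exI, rule exI, rule exI, rule exI, assumption)

lemma system_matrices_unique:
  assumes 1: "system_matrices b \<sigma> f A B \<AA> \<BB> C D"
    and 2: "system_matrices b \<sigma> f A' B' \<AA>' \<BB>' C' D'"
  shows "A = A' \<and> B = B' \<and> \<AA> = \<AA>' \<and> \<BB> = \<BB>' \<and> C = C' \<and> D = D'"
proof -
  have *: "M = M' \<and> L = L'"
    if "\<And>x v. M *v x + L *v v = M' *v x + L' *v v"
    for M M' :: "real^'x^'y" and L L' :: "real^'z^'y"
    using that[of _ 0] that[of 0] by (simp add: matrix_eq)
  have "A = A' \<and> B = B'" and "C = C' \<and> D = D'"
    using 1 2 unfolding system_matrices_def by (metis *)+
  moreover have "\<AA> j = \<AA>' j \<and> \<BB> j = \<BB>' j" for j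
    using 1 2 unfolding system_matrices_def by (metis *)
  ultimately show ?thesis by auto
qed

definition M_matrix ::
  "real^'d^'d \<Rightarrow> real^'d^'d \<Rightarrow> real^'n^'d
    \<Rightarrow> ('k::finite \<Rightarrow> real^'d^'d) \<Rightarrow> ('k \<Rightarrow> real^'n^'d)
    \<Rightarrow> real^'d^'n \<Rightarrow> real^'n^'n \<Rightarrow> real^('d::finite + 'n::finite)^('d + 'n)" where
  "M_matrix Q A B \<AA> \<BB> C D = block_matrix
    (Q ** A + transpose A ** Q + (\<Sum>j\<in>UNIV. transpose (\<AA> j) ** Q ** \<AA> j))
    (Q ** B - transpose C + (\<Sum>j\<in>UNIV. transpose (\<AA> j) ** Q ** \<BB> j))
    (transpose B ** Q - C + (\<Sum>j\<in>UNIV. transpose (\<BB> j) ** Q ** \<AA> j))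
    (- (D + transpose D) + (\<Sum>j\<in>UNIV. transpose (\<BB> j) ** Q ** \<BB> j))"

end

theory Submission
  imports Defs
begin

text \<open>Substituting the port-Hamiltonian form of the system matrices into \<open>\<MM>\<^sub>Q\<close>, the parts
  containing \<open>J\<close>, \<open>N\<close>, \<open>F\<close> and all diffusion terms cancel, and what remains is
  \<open>-2\<close> times the congruence of the dissipation matrix with blocks \<open>R, P, P\<^sup>T, S\<close> by
  \<open>diag(Q, I)\<close>. Its quadratic form at \<open>(x, v)\<close> is therefore \<open>-2\<close> times that of the dissipation
  matrix at \<open>(Q x, v)\<close>.\<close>

lemma transpose_add: "transpose (A + B) = transpose A + transpose (B :: 'a::plus^'n^'m)"
  by (simp add: transpose_def vec_eq_iff)

lemma transpose_diff: "transpose (A - B) = transpose A - transpose (B :: 'a::minus^'n^'m)"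
  by (simp add: transpose_def vec_eq_iff)

lemma transpose_uminus: "transpose (- A) = - transpose (A :: 'a::uminus^'n^'m)"
  by (simp add: transpose_def vec_eq_iff)

lemma transpose_sum:
  "transpose (\<Sum>j\<in>I. A j) = (\<Sum>j\<in>I. transpose (A j :: 'a::comm_monoid_add^'n^'m))"
  by (simp add: transpose_def vec_eq_iff)

lemma matrix_add_rdistrib: "(A + B) ** C = A ** C + (B :: 'a::semiring_1^'n^'m) ** C"
  by (simp add: matrix_matrix_mult_def vec_eq_iff sum.distrib distrib_right)

lemma matrix_diff_ldistrib: "A ** (B - C) = A ** B - A ** (C :: 'a::ring_1^'p^'n)"
  by (simp add: matrix_matrix_mult_def vec_eq_iff sum_subtractf right_diff_distrib)

lemma matrix_diff_rdistrib: "(A - B) ** C = A ** C - (B :: 'a::ring_1^'n^'m) ** C"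
  by (simp add: matrix_matrix_mult_def vec_eq_iff sum_subtractf left_diff_distrib)

lemma matrix_uminus_left: "(- A) ** B = - (A ** (B :: 'a::ring_1^'p^'n))"
  by (simp add: matrix_matrix_mult_def vec_eq_iff sum_negf)

lemma matrix_uminus_right: "A ** (- B) = - (A ** (B :: 'a::ring_1^'p^'n))"
  by (simp add: matrix_matrix_mult_def vec_eq_iff sum_negf)

lemma matrix_mult_sum_left:
  "(\<Sum>j\<in>I. A j) ** B = (\<Sum>j\<in>I. A j ** (B :: 'a::semiring_1^'p^'n))"
  by (induction I rule: infinite_finite_induct)
     (simp_all add: matrix_add_rdistrib)

lemma matrix_mult_sum_right:
  "B ** (\<Sum>j\<in>I. A j) = (\<Sum>j\<in>I. B ** (A j :: 'a::semiring_1^'p^'n))"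
  by (induction I rule: infinite_finite_induct)
     (simp_all add: matrix_add_ldistrib)

lemma transpose_block_matrix:
  "transpose (block_matrix A B C D)
    = block_matrix (transpose A) (transpose C) (transpose B) (transpose D)"
  by (simp add: block_matrix_def transpose_def vec_eq_iff split: sum.split)

lemma block_matrix_eq_iff:
  "block_matrix A B C D = block_matrix A' B' C' D' \<longleftrightarrow> A = A' \<and> B = B' \<and> C = C' \<and> D = D'"
  by (auto simp: block_matrix_def vec_eq_iff split_sum_all)

lemma sum_UNIV_sum_type:
  "(\<Sum>i\<in>(UNIV :: ('a::finite + 'b::finite) set). g i)
    = (\<Sum>a\<in>UNIV. g (Inl a)) + (\<Sum>b\<in>UNIV. g (Inr b))"
  by (simp add: UNIV_Plus_UNIV[symmetric] sum.Plus del: UNIV_Plus_UNIV)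

text \<open>Lets quadratic forms of two block matrices, taken at different vectors, be compared
  block by block.\<close>

lemma block_matrix_quadratic_form:
  fixes z :: "real^('d::finite + 'n::finite)"
  defines "x \<equiv> \<chi> a. z $ Inl a" and "v \<equiv> \<chi> e. z $ Inr e"
  shows "z \<bullet> (block_matrix A B C D *v z)
    = x \<bullet> (A *v x) + x \<bullet> (B *v v) + v \<bullet> (C *v x) + v \<bullet> (D *v v)"
  by (simp add: x_def v_def inner_vec_def matrix_vector_mult_def block_matrix_def
      sum_UNIV_sum_type sum.distrib distrib_left)

lemma port_hamiltonian_M_matrix:
  assumes Q: "transpose Q = Q" and J: "transpose J = - J" and R: "transpose R = R"
    and S: "transpose S = S" and N: "transpose N = - N"
  shows "M_matrix Q
      ((J - R - (1/2) *\<^sub>R (\<Sum>j\<in>UNIV. transpose (Aq j) ** Q ** Aq j)) ** Q) (F - P)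
      (\<lambda>i. Aq i ** Q) \<BB>
      (transpose (F + P + (\<Sum>j\<in>UNIV. transpose (Aq j) ** Q ** \<BB> j)) ** Q)
      (S + N + (1/2) *\<^sub>R (\<Sum>j\<in>UNIV. transpose (\<BB> j) ** Q ** \<BB> j))
    = block_matrix ((-2) *\<^sub>R (Q ** R ** Q)) ((-2) *\<^sub>R (Q ** P))
        ((-2) *\<^sub>R (transpose P ** Q)) ((-2) *\<^sub>R S)"
  unfolding M_matrix_def block_matrix_eq_iff
proof (intro conjI)
  define E where "E = (\<Sum>j\<in>UNIV. transpose (Aq j) ** Q ** Aq j)"
  define G where "G = (\<Sum>j\<in>UNIV. transpose (Aq j) ** Q ** \<BB> j)"
  define H where "H = (\<Sum>j\<in>UNIV. transpose (\<BB> j) ** Q ** \<BB> j)"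
  \<comment> \<open>Symmetry makes the two halves of \<open>E\<close> and of \<open>H\<close> add up
    to a whole.\<close>
  have E': "transpose E = E" and H': "transpose H = H"
    by (simp_all add: E_def H_def transpose_sum matrix_transpose_mul Q matrix_mul_assoc)
  have G': "transpose G = (\<Sum>j\<in>UNIV. transpose (\<BB> j) ** Q ** Aq j)"
    by (simp add: G_def transpose_sum matrix_transpose_mul Q matrix_mul_assoc)
  \<comment> \<open>The state diffusion matrices carry a right factor \<open>Q\<close>; it leaves
    the sums on the right, and on the left after transposition.\<close>
  have 1: "(\<Sum>j\<in>UNIV. transpose (Aq j ** Q) ** Q ** (Aq j ** Q)) = Q ** E ** Q"
    by (simp add: E_def matrix_mult_sum_left matrix_mult_sum_right matrix_transpose_mul Q
        matrix_mul_assoc)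
  have 2: "(\<Sum>j\<in>UNIV. transpose (Aq j ** Q) ** Q ** \<BB> j) = Q ** G"
    by (simp add: G_def matrix_mult_sum_right matrix_transpose_mul Q matrix_mul_assoc)
  have 3: "(\<Sum>j\<in>UNIV. transpose (\<BB> j) ** Q ** (Aq j ** Q)) = transpose G ** Q"
    by (simp add: G' matrix_mult_sum_left matrix_mul_assoc)
  \<comment> \<open>Expanding all products and transposes leaves identities that are linear in the
    entries of the remaining products.\<close>
  note distribs = matrix_add_ldistrib matrix_add_rdistrib matrix_diff_ldistrib matrix_diff_rdistrib
    matrix_uminus_left matrix_uminus_right transpose_add transpose_diff transpose_uminus
    transpose_scalar matrix_transpose_mul scalar_matrix_assoc[symmetric] matrix_scalar_ac
    matrix_mul_assoc
  \<comment> \<open>\<open>Q ** J ** Q\<close> is skew and cancels against its transpose,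
    \<open>Q ** R ** Q\<close> doubles, and the two halves of \<open>- Q ** E ** Q\<close> absorb
    the sum.\<close>
  show "Q ** ((J - R - (1/2) *\<^sub>R E) ** Q) + transpose ((J - R - (1/2) *\<^sub>R E) ** Q) ** Q
      + (\<Sum>j\<in>UNIV. transpose (Aq j ** Q) ** Q ** (Aq j ** Q)) = (-2) *\<^sub>R (Q ** R ** Q)"
    unfolding 1 by (simp add: distribs Q J R E' vec_eq_iff)
  \<comment> \<open>Here \<open>F\<close> and \<open>G\<close> cancel, while \<open>P\<close> enters
    input and output with opposite signs and so doubles.\<close>
  show "Q ** (F - P) - transpose (transpose (F + P + G) ** Q)
      + (\<Sum>j\<in>UNIV. transpose (Aq j ** Q) ** Q ** \<BB> j) = (-2) *\<^sub>R (Q ** P)"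
    unfolding 2 by (simp add: distribs Q vec_eq_iff)
  show "transpose (F - P) ** Q - transpose (F + P + G) ** Q
      + (\<Sum>j\<in>UNIV. transpose (\<BB> j) ** Q ** (Aq j ** Q)) = (-2) *\<^sub>R (transpose P ** Q)"
    unfolding 3 by (simp add: distribs vec_eq_iff)
  show "- (S + N + (1/2) *\<^sub>R H + transpose (S + N + (1/2) *\<^sub>R H)) + H = (-2) *\<^sub>R S"
    by (simp add: distribs S N H' vec_eq_iff)
qed

theorem lemma9p3:
  fixes b :: "(real^'d) \<times> (real^'n) \<Rightarrow> real^'d"
    and \<sigma> :: "(real^'d) \<times> (real^'n) \<Rightarrow> real^'k^'d"
    and f :: "(real^'d) \<times> (real^'n) \<Rightarrow> real^'n"
    and Q A :: "real^'d^'d" and B :: "real^'n^'d"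
    and \<AA> :: "'k \<Rightarrow> real^'d^'d" and \<BB> :: "'k \<Rightarrow> real^'n^'d"
    and C :: "real^'d^'n" and D :: "real^'n^'n"
  assumes "pos_semidef Q"
    and "slti_phs_with Q b \<sigma> f"
    and "system_matrices b \<sigma> f A B \<AA> \<BB> C D"
  shows "neg_semidef (M_matrix Q A B \<AA> \<BB> C D)"
proof -
  \<comment> \<open>The coefficient equations are recorded as \<open>system_matrices\<close>, so
    that uniqueness identifies the given matrices with the structured ones.\<close>
  obtain J R Aq F P B' S N where J: "J = - transpose J" and R: "R = transpose R"
    and S: "S = transpose S" and N: "N = - transpose N"
    and psd: "pos_semidef (block_matrix R P (transpose P) S)"
    and sys: "system_matrices b \<sigma> f
      ((J - R - (1/2) *\<^sub>R (\<Sum>j\<in>UNIV. transpose (Aq j) ** Q ** Aq j)) ** Q) (F - P)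
      (\<lambda>i. Aq i ** Q) B'
      (transpose (F + P + (\<Sum>j\<in>UNIV. transpose (Aq j) ** Q ** B' j)) ** Q)
      (S + N + (1/2) *\<^sub>R (\<Sum>j\<in>UNIV. transpose (B' j) ** Q ** B' j))"
    using assms(2) unfolding slti_phs_with_def
    by (elim conjE exE) (rule that[unfolded system_matrices_def])
  have Q: "transpose Q = Q"
    using assms(1) by (simp add: pos_semidef_def)
  have J': "transpose J = - J" and N': "transpose N = - N"
    using arg_cong[OF J, of uminus] arg_cong[OF N, of uminus] by simp_all
  have "M_matrix Q A B \<AA> \<BB> C D
    = block_matrix ((-2) *\<^sub>R (Q ** R ** Q)) ((-2) *\<^sub>R (Q ** P))
        ((-2) *\<^sub>R (transpose P ** Q)) ((-2) *\<^sub>R S)" (is "?M = ?B")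
    using system_matrices_unique[OF assms(3) sys]
    by (simp only: port_hamiltonian_M_matrix[OF Q J' R[symmetric] S[symmetric] N'])
  moreover have "neg_semidef ?B"
    unfolding neg_semidef_def
  proof (intro conjI allI)
    show "transpose ?B = ?B"
      by (simp add: transpose_block_matrix transpose_uminus transpose_scalar matrix_transpose_mul Q
          R[symmetric] S[symmetric] matrix_mul_assoc)
  next
    fix z :: "real^('d + 'n)"
    define x v where "x = (\<chi> a. z $ Inl a)" and "v = (\<chi> e. z $ Inr e)"
    \<comment> \<open>\<open>w\<close> is the stacked vector \<open>(Q x, v)\<close>, the image of
      \<open>z\<close> under \<open>diag(Q, I)\<close>.\<close>
    define w :: "real^('d + 'n)" where
      "w = (\<chi> i. case i of Inl a \<Rightarrow> (Q *v x) $ a | Inr e \<Rightarrow> v $ e)"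
    have w: "(\<chi> a. w $ Inl a) = Q *v x" "(\<chi> e. w $ Inr e) = v"
      by (simp_all add: w_def)
    \<comment> \<open>Self-adjointness of \<open>Q\<close> turns the left argument
      \<open>Q x\<close> of the form at \<open>w\<close> into the outer factor \<open>Q\<close> of
      the blocks of \<open>?B\<close>.\<close>
    have Q_adj: "(Q *v x) \<bullet> y = x \<bullet> (Q *v y)" for y
      by (metis Q dot_lmul_matrix vector_transpose_matrix)
    have "z \<bullet> (?B *v z) = (-2) * (w \<bullet> (block_matrix R P (transpose P) S *v w))"
      unfolding block_matrix_quadratic_form w x_def[symmetric] v_def[symmetric]
      by (simp only: Q_adj scaleR_matrix_vector_assoc[symmetric] inner_scaleR_right
          matrix_vector_mul_assoc[symmetric] distrib_left)
    moreover have "0 \<le> w \<bullet> (block_matrix R P (transpose P) S *v w)"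
      using psd by (simp add: pos_semidef_def)
    ultimately show "z \<bullet> (?B *v z) \<le> 0"
      by simp
  qed
  ultimately show ?thesis
    by simp
qed

end
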